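(* Let $m>0$, $\beta>0$, $\gamma>0$ be constants and let $\boldsymbol{\alpha}\in\mathbb{R}^3$ be a constant vector. For each choice of sign $\pm$ (fixed consistently throughout), let, for $\mathbf{p}\in\mathbb{R}^3$, $$E(\mathbf{p})=E_\pm(\mathbf{p})=\frac{|\mathbf{p}|^2}{2m}\pm\sqrt{(\boldsymbol{\alpha}\cdot\mathbf{p})^2+\gamma^2},\qquad \mathbf{v}(\mathbf{p})=\mathbf{v}_\pm(\mathbf{p})=\nabla_{\mathbf{p}}E_\pm(\mathbf{p})=\frac{\mathbf{p}}{m}\pm\frac{\boldsymbol{\alpha}\cdot\mathbf{p}}{\sqrt{(\boldsymbol{\alpha}\cdot\mathbf{p})^2+\gamma^2}}\,\boldsymbol{\alpha},$$ and define $f:\mathbb{R}^3\to\mathbb{R}$ by $$e^{f(\mathbf{B})}=\int_{\mathbb{R}^3}e^{-\beta E(\mathbf{p})+\mathbf{B}\cdot\mathbf{v}(\mathbf{p})}\,d\mathbf{p},\qquad \mathbf{B}\in\mathbb{R}^3.$$ Then the mapping $\mathbf{B}\in\mathbb{R}^3\mapsto\nabla_{\mathbf{B}}f(\mathbf{B})\in\mathbb{R}^3$ is globally invertible, i.e. it is a bijection of $\mathbb{R}^3$ onto $\mathbb{R}^3$.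
   Context: Here $\cdot$ and $|\cdot|$ denote the Euclidean scalar product and norm on $\mathbb{R}^3$. The functions $E_\pm$ are the upper and lower energy bands of a two-band ($k\cdot p$) model of a semiconductor, $m$ is the electron mass, $\gamma$ is half the band gap, $\boldsymbol{\alpha}$ is the (rescaled) interband matrix element of the gradient operator, and $\beta=(k_BT)^{-1}$ is the inverse temperature. The result is asserted separately for each of the two signs (the two band problems are decoupled). *)

theory Defs
  imports "HOL-Analysis.Analysis"
begin

text \<open>The description operator picks the gradient out where it exists; it is unspecified
  at points where the function is not differentiable.\<close>

definition gradient :: "('a::real_inner \<Rightarrow> real) \<Rightarrow> 'a \<Rightarrow> 'a" where
  "gradient f x = (THE D. GDERIV f x :> D)"

lemma gradient_eq:
  assumes "GDERIV f x :> D"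
  shows "gradient f x = D"
  unfolding gradient_def
proof (rule the_equality)
  fix D' assume "GDERIV f x :> D'"
  hence "(\<lambda>h. h \<bullet> D') = (\<lambda>h. h \<bullet> D)"
    using assms unfolding gderiv_def by (rule has_derivative_unique)
  hence "\<forall>h. h \<bullet> D' = h \<bullet> D"
    by (simp add: fun_eq_iff)
  thus "D' = D"
    by (simp only: vector_eq_ldot)
qed (rule assms)

text \<open>The sign of the band is the parameter \<open>\<sigma>\<close>, meant to be \<open>1\<close> (upper band) or
  \<open>- 1\<close> (lower band).\<close>

definition band_energy :: "real \<Rightarrow> real \<Rightarrow> real \<Rightarrow> real^3 \<Rightarrow> real^3 \<Rightarrow> real" where
  "band_energy \<sigma> m \<gamma> \<alpha> p = (norm p)\<^sup>2 / (2 * m) + \<sigma> * sqrt ((\<alpha> \<bullet> p)\<^sup>2 + \<gamma>\<^sup>2)"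

definition band_velocity :: "real \<Rightarrow> real \<Rightarrow> real \<Rightarrow> real^3 \<Rightarrow> real^3 \<Rightarrow> real^3" where
  "band_velocity \<sigma> m \<gamma> \<alpha> p = gradient (band_energy \<sigma> m \<gamma> \<alpha>) p"

lemma GDERIV_band_energy:
  assumes "m > 0" "\<gamma> > 0"
  shows "GDERIV (band_energy \<sigma> m \<gamma> \<alpha>) p :>
    p /\<^sub>R m + (\<sigma> * ((\<alpha> \<bullet> p) / sqrt ((\<alpha> \<bullet> p)\<^sup>2 + \<gamma>\<^sup>2))) *\<^sub>R \<alpha>"
proof -
  have E: "band_energy \<sigma> m \<gamma> \<alpha> =
      (\<lambda>p. (p \<bullet> p) / (2 * m) + \<sigma> * sqrt ((\<alpha> \<bullet> p)\<^sup>2 + \<gamma>\<^sup>2))"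
    by (rule ext) (simp add: band_energy_def power2_norm_eq_inner)
  have "((\<lambda>p. p \<bullet> p) has_derivative (\<lambda>h. p \<bullet> h + h \<bullet> p)) (at p)"
    by (rule has_derivative_inner) (rule has_derivative_ident)+
  from has_derivative_divide[OF this has_derivative_const, of "2 * m"]
  have D1: "((\<lambda>p. (p \<bullet> p) / (2 * m)) has_derivative (\<lambda>h. (p \<bullet> h) / m)) (at p)"
    using assms by (simp add: inner_commute divide_simps)
  have "((\<lambda>p. \<alpha> \<bullet> p) has_derivative (\<lambda>h. \<alpha> \<bullet> h)) (at p)"
    by (rule has_derivative_inner_right) (rule has_derivative_ident)
  moreover have "((\<lambda>x. sqrt (x\<^sup>2 + \<gamma>\<^sup>2)) has_real_derivative
      x / sqrt (x\<^sup>2 + \<gamma>\<^sup>2)) (at x)" for x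
  proof -
    have "x\<^sup>2 + \<gamma>\<^sup>2 > 0"
      using assms by (simp add: add_nonneg_pos)
    thus ?thesis
      by (auto intro!: derivative_eq_intros simp: field_simps)
  qed
  ultimately have D2: "((\<lambda>p. sqrt ((\<alpha> \<bullet> p)\<^sup>2 + \<gamma>\<^sup>2)) has_derivative
      (\<lambda>h. (\<alpha> \<bullet> h) * ((\<alpha> \<bullet> p) / sqrt ((\<alpha> \<bullet> p)\<^sup>2 + \<gamma>\<^sup>2)))) (at p)"
    by (rule DERIV_compose_FDERIV[rotated])
  let ?c = "(\<alpha> \<bullet> p) / sqrt ((\<alpha> \<bullet> p)\<^sup>2 + \<gamma>\<^sup>2)"
  have "(\<lambda>h. (p \<bullet> h) / m + \<sigma> * ((\<alpha> \<bullet> h) * ?c)) =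
      (\<lambda>h. h \<bullet> (p /\<^sub>R m + (\<sigma> * ?c) *\<^sub>R \<alpha>))"
  proof
    fix h
    have "h \<bullet> (p /\<^sub>R m + (\<sigma> * c) *\<^sub>R \<alpha>) = (p \<bullet> h) / m + \<sigma> * ((\<alpha> \<bullet> h) * c)" for c
      unfolding inner_add_right inner_scaleR_right inner_commute[of h]
      by (simp only: divide_inverse mult_ac)
    thus "(p \<bullet> h) / m + \<sigma> * ((\<alpha> \<bullet> h) * ?c) = h \<bullet> (p /\<^sub>R m + (\<sigma> * ?c) *\<^sub>R \<alpha>)"
      by (rule sym)
  qed
  with has_derivative_add[OF D1 has_derivative_mult_right[OF D2, of \<sigma>]] show ?thesis
    unfolding gderiv_def E by (simp only:)
qed

lemma band_velocity_eq:
  assumes "m > 0" "\<gamma> > 0"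
  shows "band_velocity \<sigma> m \<gamma> \<alpha> p =
    p /\<^sub>R m + (\<sigma> * ((\<alpha> \<bullet> p) / sqrt ((\<alpha> \<bullet> p)\<^sup>2 + \<gamma>\<^sup>2))) *\<^sub>R \<alpha>"
  unfolding band_velocity_def by (rule gradient_eq[OF GDERIV_band_energy[OF assms]])

text \<open>The logarithm solves \<open>exp (f B) = \<integral> \<dots>\<close> for \<open>f B\<close> only if the integral is positive.
  Since the Bochner integral of a non-integrable function is \<open>0\<close>, positivity of the integral
  includes its convergence.\<close>

definition log_partition ::
    "real \<Rightarrow> real \<Rightarrow> real \<Rightarrow> real \<Rightarrow> real^3 \<Rightarrow> real^3 \<Rightarrow> real" where
  "log_partition \<sigma> m \<beta> \<gamma> \<alpha> B =
    ln (LINT p|lborel. exp (- \<beta> * band_energy \<sigma> m \<gamma> \<alpha> p + B \<bullet> band_velocity \<sigma> m \<gamma> \<alpha> p))"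

end

theory Submission
  imports Defs "HOL-Probability.Distributions"
begin

text \<open>Under the finite measure with density \<open>exp (- \<beta> E)\<close>, \<open>exp f\<close> is the moment generating function
  of the velocity, and \<open>\<nabla>f B\<close> is the mean velocity under the tilted weight \<open>exp (B \<bullet> v)\<close>. All
  exponential moments are finite because \<open>E\<close> grows quadratically while \<open>v\<close> grows linearly. Two
  tilts with the same mean would force \<open>v\<close> into a hyperplane. A tilt with mean \<open>y\<close> is a critical
  point of \<open>\<integral> exp (B \<bullet> (v - y))\<close>, whose minimum exists because the velocity is unbounded in
  every direction, which makes this function of \<open>B\<close> coercive.\<close>

section \<open>Elementary bounds for the exponential\<close>

lemma abs_exp_minus_one_le: "\<bar>exp x - 1\<bar> \<le> \<bar>x\<bar> * exp \<bar>x\<bar>" for x :: real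
proof -
  have "1 - x \<le> exp (- x)" "1 + x \<le> exp x"
    using exp_ge_add_one_self[of "- x"] by simp_all
  then have "exp x * (1 - x) \<le> exp x * exp (- x)" "1 + x \<le> exp x"
    by (intro mult_left_mono) auto
  then have "exp x - 1 \<le> x * exp x" "x \<le> exp x - 1"
    by (simp_all add: algebra_simps flip: exp_add)
  moreover have "\<bar>x\<bar> \<le> \<bar>x\<bar> * exp \<bar>x\<bar>"
    by (simp add: mult_le_cancel_left1)
  moreover have "\<bar>exp x - 1\<bar> = (if x \<ge> 0 then exp x - 1 else 1 - exp x)"
    by simp
  ultimately show ?thesis
    by (smt (verit))
qed

text \<open>Convexity gives nonnegativity, and multiplying \<open>1 - x \<le> exp (- x)\<close> by
  \<open>exp x\<close> bounds the remainder by \<open>x * (exp x - 1)\<close>. The second factor of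
  order \<open>x\<close> comes from \<open>abs_exp_minus_one_le\<close>.\<close>

lemma exp_minus_tangent_le: "\<bar>exp x - 1 - x\<bar> \<le> x\<^sup>2 * exp \<bar>x\<bar>" for x :: real
proof -
  have "1 - x \<le> exp (- x)" and nonneg: "1 + x \<le> exp x"
    using exp_ge_add_one_self[of "- x"] by simp_all
  then have "exp x * (1 - x) \<le> exp x * exp (- x)"
    by (intro mult_left_mono) auto
  then have "exp x - 1 - x \<le> x * (exp x - 1)"
    by (simp add: algebra_simps flip: exp_add)
  also have "\<dots> \<le> \<bar>x\<bar> * \<bar>exp x - 1\<bar>"
    by (metis abs_ge_self abs_mult)
  also have "\<dots> \<le> \<bar>x\<bar> * (\<bar>x\<bar> * exp \<bar>x\<bar>)"
    by (intro mult_left_mono abs_exp_minus_one_le) auto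
  also have "\<dots> = x\<^sup>2 * exp \<bar>x\<bar>"
    by (simp add: power2_eq_square flip: mult.assoc)
  finally show ?thesis
    using nonneg by linarith
qed

lemma power2_le_exp: "t\<^sup>2 \<le> 2 * exp t" if "t \<ge> 0" for t :: real
  using exp_lower_Taylor_quadratic[OF that] that by (simp add: field_simps)

section \<open>Exponential families with finite exponential moments\<close>

text \<open>\<open>M\<close> need not be normalised; \<open>integrable_exp_norm\<close> at
  \<open>r = 0\<close> makes it finite. As \<open>c\<close> is arbitrary,
  \<open>nondegenerate\<close> says that \<open>v\<close> is essentially unbounded above in every
  direction, a property that survives translation of \<open>v\<close>.\<close>

locale exponential_family =
  fixes M :: "'a measure" and v :: "'a \<Rightarrow> 'b::euclidean_space"
  assumes measurable_v [measurable]: "v \<in> borel_measurable M"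
    and integrable_exp_norm: "\<And>r. integrable M (\<lambda>p. exp (r * norm (v p)))"
    and nondegenerate: "\<And>u c. u \<noteq> 0 \<Longrightarrow> \<not> (AE p in M. u \<bullet> v p \<le> c)"
begin

definition partition_function :: "'b \<Rightarrow> real" where
  "partition_function B = (LINT p|M. exp (B \<bullet> v p))"

definition moment :: "'b \<Rightarrow> 'b" where
  "moment B = (LINT p|M. exp (B \<bullet> v p) *\<^sub>R v p)"

lemma exp_inner_le: "exp (B \<bullet> v p) \<le> exp (norm B * norm (v p))"
  using norm_cauchy_schwarz[of B "v p"] by simp

lemma integrable_exp_inner: "integrable M (\<lambda>p. exp (B \<bullet> v p))"
  by (rule Bochner_Integration.integrable_bound[OF integrable_exp_norm[of "norm B"]])
     (use exp_inner_le in auto)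

lemma integrable_moment: "integrable M (\<lambda>p. exp (B \<bullet> v p) *\<^sub>R v p)"
\<comment> \<open>The factor \<open>norm (v p)\<close> is absorbed by
  \<open>exp (norm (v p))\<close>, which raises the exponent by one.\<close>
proof (rule Bochner_Integration.integrable_bound[OF integrable_exp_norm[of "norm B + 1"]])
  have "exp (B \<bullet> v p) * norm (v p) \<le> exp (norm B * norm (v p)) * exp (norm (v p))" for p
    using exp_ge_add_one_self[of "norm (v p)"]
    by (intro mult_mono exp_inner_le) (auto simp del: exp_ge_add_one_self)
  then show "AE p in M. norm (exp (B \<bullet> v p) *\<^sub>R v p) \<le> norm (exp ((norm B + 1) * norm (v p)))"
    by (simp add: exp_add algebra_simps)
qed simp

lemma integrable_norm_v: "integrable M (\<lambda>p. norm (v p))"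
  using integrable_norm[OF integrable_moment[of 0]] by simp

text \<open>The measure is not zero: otherwise every bound on \<open>v\<close> would hold almost
  everywhere, against \<open>nondegenerate\<close> in a basis direction.\<close>

lemma not_AE_False: "\<not> (AE p in M. False)"
proof
  assume "AE p in M. False"
  then have "AE p in M. u \<bullet> v p \<le> 0" for u
    by eventually_elim auto
  with nondegenerate[of "SOME b. b \<in> Basis" 0] show False
    using nonzero_Basis some_in_eq[of "Basis :: 'b set"] nonempty_Basis by metis
qed

lemma partition_pos: "partition_function B > 0"
proof -
  have "partition_function B \<noteq> 0"
    unfolding partition_function_def
    using integral_nonneg_eq_0_iff_AE[OF integrable_exp_inner[of B]] not_AE_False by simp
  moreover have "partition_function B \<ge> 0"
    unfolding partition_function_def by simp
  ultimately show ?thesis by simp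
qed

section \<open>Gradient of the log-partition function and its injectivity\<close>

text \<open>The tangent estimate for \<open>exp\<close> is applied pointwise to
  \<open>h \<bullet> v p\<close> and integrated. The restriction on \<open>h\<close> makes the
  constant independent of \<open>h\<close>.\<close>

lemma partition_first_order:
  assumes "norm h \<le> 1"
  shows "\<bar>partition_function (B + h) - partition_function B - h \<bullet> moment B\<bar>
    \<le> (norm h)\<^sup>2 * (LINT p|M. 2 * exp ((norm B + 2) * norm (v p)))"
proof -
  have "partition_function (B + h) - partition_function B - h \<bullet> moment B
      = (LINT p|M. exp ((B + h) \<bullet> v p) - exp (B \<bullet> v p) - h \<bullet> (exp (B \<bullet> v p) *\<^sub>R v p))"
    unfolding partition_function_def moment_def
    using integrable_exp_inner integrable_moment
    by (simp del: inner_scaleR_right)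
  also have "\<bar>\<dots>\<bar> \<le> (LINT p|M. (norm h)\<^sup>2 * (2 * exp ((norm B + 2) * norm (v p))))"
  proof -
    have "\<bar>exp ((B + h) \<bullet> v p) - exp (B \<bullet> v p) - h \<bullet> (exp (B \<bullet> v p) *\<^sub>R v p)\<bar>
        \<le> (norm h)\<^sup>2 * (2 * exp ((norm B + 2) * norm (v p)))" for p
    proof -
      let ?x = "h \<bullet> v p" and ?n = "norm (v p)"
      have x: "\<bar>?x\<bar> \<le> norm h * ?n"
        by (rule Cauchy_Schwarz_ineq2)
      also have "\<dots> \<le> ?n"
        using assms by (simp add: mult_left_le_one_le)
      finally have x': "\<bar>?x\<bar> \<le> ?n" .
      have "\<bar>exp ((B + h) \<bullet> v p) - exp (B \<bullet> v p) - h \<bullet> (exp (B \<bullet> v p) *\<^sub>R v p)\<bar>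
          = exp (B \<bullet> v p) * \<bar>exp ?x - 1 - ?x\<bar>"
        by (subst (2) abs_of_pos[symmetric, OF exp_gt_zero])
          (simp only: abs_mult[symmetric], simp add: inner_add_left exp_add algebra_simps)
      also have "\<dots> \<le> exp (norm B * ?n) * (?x\<^sup>2 * exp \<bar>?x\<bar>)"
        by (intro mult_mono exp_inner_le exp_minus_tangent_le) auto
      \<comment> \<open>One \<open>exp ?n\<close> pays for the square of \<open>?n\<close>, the
        other bounds \<open>exp \<bar>?x\<bar>\<close>; together they produce the \<open>2\<close>
        in \<open>norm B + 2\<close>.\<close>
      also have "\<dots> \<le> exp (norm B * ?n) * (((norm h)\<^sup>2 * (2 * exp ?n)) * exp ?n)"
      proof -
        have "?x\<^sup>2 \<le> (norm h)\<^sup>2 * ?n\<^sup>2"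
          using power_mono[OF x, of 2] by (simp add: power_mult_distrib)
        also have "\<dots> \<le> (norm h)\<^sup>2 * (2 * exp ?n)"
          by (intro mult_left_mono power2_le_exp) auto
        finally show ?thesis
          using x' by (intro mult_left_mono mult_mono) auto
      qed
      also have "\<dots> = (norm h)\<^sup>2 * (2 * exp ((norm B + 2) * ?n))"
        by (simp add: distrib_right exp_add exp_double power2_eq_square)
      finally show ?thesis .
    qed
    then show ?thesis
      using integrable_exp_inner integrable_moment integrable_exp_norm
      by (intro order_trans[OF integral_abs_bound integral_mono])
        (auto simp del: inner_scaleR_right)
  qed
  finally show ?thesis
    by simp
qed

lemma GDERIV_partition: "GDERIV partition_function B :> moment B"
proof -
  define C where "C = (LINT p|M. 2 * exp ((norm B + 2) * norm (v p)))"
  have "((\<lambda>h. norm (partition_function (B + h) - partition_function B - h \<bullet> moment B) / norm h) \<longlongrightarrow> 0) (at 0)"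
  proof (rule Lim_null_comparison)
    have "\<forall>\<^sub>F h in at 0. norm (h::'b) < 1"
      unfolding eventually_at by (rule exI[of _ 1]) simp
    then show "\<forall>\<^sub>F h in at 0. norm (norm (partition_function (B + h) - partition_function B - h \<bullet> moment B) / norm h)
        \<le> norm h * C"
    proof eventually_elim
      case (elim h)
      then show ?case
        using partition_first_order[of h B]
        \<comment> \<open>At \<open>h = 0\<close> the quotient is \<open>0\<close> by the convention
          for division by zero.\<close>
        by (cases "h = 0") (auto simp: C_def divide_simps power2_eq_square mult_ac)
    qed
    show "((\<lambda>h. norm h * C) \<longlongrightarrow> 0) (at (0::'b))"
      by (auto intro!: tendsto_eq_intros)
  qed
  then show ?thesis
    unfolding gderiv_def has_derivative_at
    by (auto intro: bounded_linear_inner_left)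
qed

lemma GDERIV_ln_partition: "GDERIV (\<lambda>B. ln (partition_function B)) B :> moment B /\<^sub>R partition_function B"
  using GDERIV_DERIV_compose[OF GDERIV_partition DERIV_ln[OF partition_pos]]
  by simp

lemma continuous_on_partition: "continuous_on S partition_function"
  using GDERIV_partition unfolding gderiv_def
  by (meson continuous_at_imp_continuous_on has_derivative_continuous)

text \<open>The directional mean of the velocity cannot agree at two points: with
  \<open>X = (B' - B) \<bullet> v\<close> and \<open>a\<close> its common mean, the nonnegative function
  \<open>(X - a) * (exp X - exp a)\<close> would have mean \<open>0\<close> under the weight \<open>exp (B \<bullet> v)\<close>.\<close>

lemma inj_mean: "inj (\<lambda>B. moment B /\<^sub>R partition_function B)"
proof (rule injI, rule ccontr)
  fix B B' assume eq: "moment B /\<^sub>R partition_function B = moment B' /\<^sub>R partition_function B'" and "B \<noteq> B'"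
  define u where "u = B' - B"
  define a where "a = u \<bullet> (moment B /\<^sub>R partition_function B)"
  have mean: "integrable M (\<lambda>p. exp (D \<bullet> v p) * (u \<bullet> v p - a))"
      "(LINT p|M. exp (D \<bullet> v p) * (u \<bullet> v p - a)) = u \<bullet> moment D - a * partition_function D" for D
  proof -
    have *: "(\<lambda>p. exp (D \<bullet> v p) * (u \<bullet> v p - a))
        = (\<lambda>p. u \<bullet> (exp (D \<bullet> v p) *\<^sub>R v p) - a * exp (D \<bullet> v p))"
      by (auto simp: algebra_simps)
    show "integrable M (\<lambda>p. exp (D \<bullet> v p) * (u \<bullet> v p - a))"
      unfolding * using integrable_exp_inner integrable_moment
      by (simp del: inner_scaleR_right)
    show "(LINT p|M. exp (D \<bullet> v p) * (u \<bullet> v p - a)) = u \<bullet> moment D - a * partition_function D"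
      unfolding * partition_function_def moment_def using integrable_exp_inner integrable_moment
      by (simp del: inner_scaleR_right)
  qed
  have "u \<bullet> moment B - a * partition_function B = 0"
    using partition_pos[of B] by (simp add: a_def)
  moreover have "u \<bullet> moment B' - a * partition_function B' = 0"
    using partition_pos[of B'] by (simp add: a_def eq)
  ultimately have zero:
      "integrable M (\<lambda>p. exp (B' \<bullet> v p) * (u \<bullet> v p - a) - exp a * (exp (B \<bullet> v p) * (u \<bullet> v p - a)))"
      "(LINT p|M. exp (B' \<bullet> v p) * (u \<bullet> v p - a) - exp a * (exp (B \<bullet> v p) * (u \<bullet> v p - a))) = 0"
    using mean by simp_all
  have split: "exp (B' \<bullet> v p) * (u \<bullet> v p - a) - exp a * (exp (B \<bullet> v p) * (u \<bullet> v p - a))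
      = exp (B \<bullet> v p) * ((u \<bullet> v p - a) * (exp (u \<bullet> v p) - exp a))" for p
  proof -
    have "exp (B' \<bullet> v p) = exp (B \<bullet> v p) * exp (u \<bullet> v p)"
      by (simp add: u_def inner_diff_left flip: exp_add)
    then show ?thesis
      by (simp add: algebra_simps)
  qed
  have nonneg: "(u \<bullet> v p - a) * (exp (u \<bullet> v p) - exp a) \<ge> 0" for p
    by (cases "u \<bullet> v p \<le> a") (auto simp: zero_le_mult_iff)
  have "AE p in M. exp (B' \<bullet> v p) * (u \<bullet> v p - a) - exp a * (exp (B \<bullet> v p) * (u \<bullet> v p - a)) = 0"
    using integral_nonneg_eq_0_iff_AE[OF zero(1)] zero(2) nonneg unfolding split by simp
  \<comment> \<open>The vanishing product forces equality with \<open>a\<close>; the weaker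
    inequality is the form that \<open>nondegenerate\<close> refutes.\<close>
  then have "AE p in M. u \<bullet> v p \<le> a"
    unfolding split by eventually_elim auto
  with nondegenerate[of u a] \<open>B \<noteq> B'\<close> show False
    by (simp add: u_def)
qed

section \<open>Coercivity and surjectivity of the mean\<close>

text \<open>Since \<open>max 0 x \<le> exp x\<close>, it suffices to bound the integral
  \<open>g\<close> of the positive part. This is positively homogeneous and continuous, so its
  minimum on the unit sphere serves as \<open>\<delta>\<close>; it is positive because
  \<open>v\<close> is not confined to a half-space.\<close>

lemma partition_coercive: "\<exists>\<delta>>0. \<forall>B. \<delta> * norm B \<le> partition_function B"
proof -
  define g where "g B = (LINT p|M. max 0 (B \<bullet> v p))" for B
  have int: "integrable M (\<lambda>p. max 0 (B \<bullet> v p))" for B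
    by (rule Bochner_Integration.integrable_bound[OF integrable_exp_inner[of B]])
       (auto intro!: AE_I2 simp: max_def intro: order_trans[OF _ exp_ge_add_one_self])
  have lipschitz: "\<bar>g B - g B'\<bar> \<le> norm (B - B') * (LINT p|M. norm (v p))" for B B'
  proof -
    have "\<bar>g B - g B'\<bar> = \<bar>LINT p|M. max 0 (B \<bullet> v p) - max 0 (B' \<bullet> v p)\<bar>"
      unfolding g_def using int by simp
    also have "\<dots> \<le> (LINT p|M. norm (B - B') * norm (v p))"
    proof (rule order_trans[OF integral_abs_bound integral_mono])
      fix p
      have "\<bar>max 0 (B \<bullet> v p) - max 0 (B' \<bullet> v p)\<bar> \<le> \<bar>(B - B') \<bullet> v p\<bar>"
        by (auto simp: inner_diff_left)
      also have "\<dots> \<le> norm (B - B') * norm (v p)"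
        by (rule Cauchy_Schwarz_ineq2)
      finally show "\<bar>max 0 (B \<bullet> v p) - max 0 (B' \<bullet> v p)\<bar> \<le> norm (B - B') * norm (v p)" .
    qed (use int integrable_norm_v in auto)
    finally show ?thesis by simp
  qed
  have pos: "g B > 0" if "B \<noteq> 0" for B
  proof -
    have "g B \<noteq> 0"
    proof
      assume "g B = 0"
      then have "AE p in M. max 0 (B \<bullet> v p) = 0"
        using integral_nonneg_eq_0_iff_AE[OF int[of B]] by (simp add: g_def)
      then have "AE p in M. B \<bullet> v p \<le> 0"
        by eventually_elim (simp add: max_def split: if_splits)
      with nondegenerate[OF that] show False ..
    qed
    moreover have "g B \<ge> 0"
      unfolding g_def by simp
    ultimately show ?thesis by simp
  qed
  have cont: "continuous_on (sphere 0 1) g"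
  proof -
    have "(LINT p|M. norm (v p))-lipschitz_on (sphere 0 1) g"
      using lipschitz by (auto intro!: lipschitz_onI simp: dist_norm mult.commute)
    then show ?thesis
      by (rule lipschitz_on_continuous_on)
  qed
  obtain w where w: "w \<in> sphere 0 1" "\<And>x. x \<in> sphere 0 1 \<Longrightarrow> g w \<le> g x"
  proof -
    have "sphere (0::'b) 1 \<noteq> {}"
      by simp
    from continuous_attains_inf[OF compact_sphere this cont] that show ?thesis by blast
  qed
  have "g w * norm B \<le> partition_function B" for B
  proof (cases "B = 0")
    case True
    then show ?thesis
      using partition_pos[of B] by simp
  next
    case False
    \<comment> \<open>Normalise \<open>B\<close> to the sphere, then undo it by homogeneity of the
      positive part.\<close>
    have "g w * norm B \<le> g (B /\<^sub>R norm B) * norm B"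
      using w(2)[of "B /\<^sub>R norm B"] False by (intro mult_right_mono) auto
    also have "\<dots> = (LINT p|M. max 0 ((B /\<^sub>R norm B) \<bullet> v p) * norm B)"
      unfolding g_def by simp
    also have "\<dots> = g B"
    proof -
      have "max 0 ((B /\<^sub>R norm B) \<bullet> v p) * norm B = max 0 (B \<bullet> v p)" for p
        using False by (auto simp: max_def field_simps)
      then show ?thesis
        by (simp only: g_def)
    qed
    also have "\<dots> \<le> partition_function B"
      unfolding g_def partition_function_def
    proof (rule integral_mono[OF int integrable_exp_inner])
      fix p
      show "max 0 (B \<bullet> v p) \<le> exp (B \<bullet> v p)"
        using exp_ge_add_one_self[of "B \<bullet> v p"] exp_ge_zero[of "B \<bullet> v p"] by linarith
    qed
    finally show ?thesis .
  qed
  moreover have "g w > 0"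
    using w(1) by (intro pos) auto
  ultimately show ?thesis by blast
qed

text \<open>Coercivity and continuity yield a global minimum of \<open>partition_function\<close>,
  where its gradient vanishes.\<close>

lemma moment_has_zero: "\<exists>B. moment B = 0"
proof -
  obtain \<delta> where \<delta>: "\<delta> > 0" "\<And>B. \<delta> * norm B \<le> partition_function B"
    using partition_coercive by blast
  \<comment> \<open>Outside the ball of this radius the coercive bound exceeds
    \<open>partition_function 0\<close>, so a minimum over the ball is global.\<close>
  define R where "R = partition_function 0 / \<delta>"
  have "R \<ge> 0"
    using \<delta>(1) partition_pos[of 0] by (simp add: R_def)
  then obtain B where B: "B \<in> cball 0 R" "\<And>x. x \<in> cball 0 R \<Longrightarrow> partition_function B \<le> partition_function x"
    using continuous_attains_inf[OF compact_cball _ continuous_on_partition, of 0 R] by auto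
  have "partition_function B \<le> partition_function x" for x
  proof (cases "norm x \<le> R")
    case False
    then have "partition_function 0 < \<delta> * norm x"
      using \<delta>(1) by (simp add: R_def field_simps)
    then show ?thesis
      using B(2)[of 0] \<open>R \<ge> 0\<close> \<delta>(2)[of x] by simp
  qed (use B(2) in simp)
  then have "(\<lambda>h. h \<bullet> moment B) = (\<lambda>h. 0)"
    using GDERIV_partition[of B] unfolding gderiv_def
    by (intro differential_zero_maxmin[of B UNIV partition_function]) auto
  then have "moment B \<bullet> moment B = 0"
    by metis
  then show ?thesis
    by auto
qed

end

text \<open>Translation by \<open>y\<close> costs the moments only a constant factor and moves the
  half-space threshold from \<open>c\<close> to \<open>c + u \<bullet> y\<close>.\<close>

lemma (in exponential_family) exponential_family_shift: "exponential_family M (\<lambda>p. v p - y)"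
proof
  show "integrable M (\<lambda>p. exp (r * norm (v p - y)))" for r
  proof (rule Bochner_Integration.integrable_bound)
    show "integrable M (\<lambda>p. exp (\<bar>r\<bar> * norm y) * exp (\<bar>r\<bar> * norm (v p)))"
      using integrable_exp_norm by simp
    have "r * norm (v p - y) \<le> \<bar>r\<bar> * (norm (v p) + norm y)" for p
      using norm_triangle_ineq4[of "v p" y] by (intro mult_mono) auto
    then show "AE p in M. norm (exp (r * norm (v p - y)))
        \<le> norm (exp (\<bar>r\<bar> * norm y) * exp (\<bar>r\<bar> * norm (v p)))"
      by (simp add: algebra_simps flip: exp_add)
  qed simp
  show "\<not> (AE p in M. u \<bullet> (v p - y) \<le> c)" if "u \<noteq> 0" for u c
    using nondegenerate[OF that, of "c + u \<bullet> y"] by (simp add: inner_diff_right algebra_simps)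
qed simp

text \<open>A zero of the moment of the translated velocity \<open>v - y\<close> is a tilt under
  which \<open>v\<close> has mean \<open>y\<close>.\<close>

lemma (in exponential_family) surj_mean: "surj (\<lambda>B. moment B /\<^sub>R partition_function B)"
proof (unfold surj_def, rule allI)
  fix y
  interpret shifted: exponential_family M "\<lambda>p. v p - y"
    by (rule exponential_family_shift)
  obtain B where "shifted.moment B = 0"
    using shifted.moment_has_zero by blast
  \<comment> \<open>Translation multiplies every weight by the same positive number, so the shifted
    moment vanishes exactly when the mean is \<open>y\<close>.\<close>
  moreover have "shifted.moment B = exp (- (B \<bullet> y)) *\<^sub>R (moment B - partition_function B *\<^sub>R y)"
  proof -
    have "(\<lambda>p. exp (B \<bullet> (v p - y)) *\<^sub>R (v p - y))
        = (\<lambda>p. exp (- (B \<bullet> y)) *\<^sub>R (exp (B \<bullet> v p) *\<^sub>R v p - exp (B \<bullet> v p) *\<^sub>R y))"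
      by (auto simp: inner_diff_right exp_diff exp_minus scaleR_diff_right field_simps)
    then show ?thesis
      unfolding shifted.moment_def moment_def partition_function_def
      using integrable_moment integrable_exp_inner by simp
  qed
  ultimately have "moment B = partition_function B *\<^sub>R y"
    by simp
  then have "y = moment B /\<^sub>R partition_function B"
    using partition_pos[of B] by simp
  then show "\<exists>B. y = moment B /\<^sub>R partition_function B"
    by metis
qed

section \<open>Gaussian integrability and bounds on the bands\<close>

text \<open>The Gaussian factorises over the coordinates, and each factor is a multiple of a normal
  density.\<close>

lemma integrable_gaussian:
  assumes "k > 0"
  shows "integrable lborel (\<lambda>p::'a::euclidean_space. exp (- k * (norm p)\<^sup>2))"
proof -
  have one_dim: "integrable lborel (\<lambda>x::real. exp (- k * x\<^sup>2))"
  proof -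
    \<comment> \<open>The standard deviation for which the normal density has exponent
      \<open>- k * x\<^sup>2\<close>.\<close>
    define s where "s = 1 / sqrt (2 * k)"
    have s: "s > 0" "2 * s\<^sup>2 = 1 / k"
      using assms by (simp_all add: s_def power_divide)
    have "(\<lambda>x. sqrt (2 * pi * s\<^sup>2) * normal_density 0 s x) = (\<lambda>x. exp (- k * x\<^sup>2))"
      using s assms by (auto simp: normal_density_def field_simps)
    then show ?thesis
      using integrable_mult_right[OF integrable_normal_density[OF s(1)], of "sqrt (2 * pi * s\<^sup>2)" 0]
      by simp
  qed
  have prod: "exp (- k * (norm p)\<^sup>2) = (\<Prod>b\<in>Basis. exp (- k * (p \<bullet> b)\<^sup>2))" for p :: 'a
    unfolding power2_norm_eq_inner euclidean_inner[of p p] sum_distrib_left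
    by (simp add: exp_sum power2_eq_square)
  have "(\<integral>\<^sup>+ p. ennreal (exp (- k * (norm (p::'a))\<^sup>2)) \<partial>lborel)
      = (\<integral>\<^sup>+ p. (\<Prod>b\<in>Basis. ennreal (exp (- k * (p \<bullet> b)\<^sup>2))) \<partial>(lborel :: 'a measure))"
    by (simp only: prod) (simp add: prod_ennreal)
  also have "\<dots> = (\<Prod>b\<in>(Basis :: 'a set). \<integral>\<^sup>+ x. ennreal (exp (- k * x\<^sup>2)) \<partial>lborel)"
    by (subst nn_integral_lborel_prod) auto
  also have "\<dots> < \<infinity>"
    using one_dim by (simp add: integrable_iff_bounded power_less_top_ennreal)
  finally show ?thesis
    by (simp add: integrable_iff_bounded)
qed

text \<open>One bound covers both bands: the root is nonnegative for the upper one and grows at most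
  linearly for the lower one.\<close>

lemma band_energy_ge:
  assumes "\<gamma> > 0" "\<sigma> = 1 \<or> \<sigma> = - 1"
  shows "band_energy \<sigma> m \<gamma> \<alpha> p \<ge> (norm p)\<^sup>2 / (2 * m) - (norm \<alpha> * norm p + \<gamma>)"
proof -
  have "0 \<le> sqrt ((\<alpha> \<bullet> p)\<^sup>2 + \<gamma>\<^sup>2)" "0 \<le> norm \<alpha> * norm p"
    by simp_all
  moreover have "sqrt ((\<alpha> \<bullet> p)\<^sup>2 + \<gamma>\<^sup>2) \<le> norm \<alpha> * norm p + \<gamma>"
    using sqrt_sum_squares_le_sum_abs[of "\<alpha> \<bullet> p" \<gamma>] Cauchy_Schwarz_ineq2[of \<alpha> p] assms(1)
    by simp
  ultimately show ?thesis
    using assms unfolding band_energy_def by (elim disjE) (simp_all del: real_sqrt_ge_0_iff)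
qed

lemma abs_band_factor_le:
  assumes "\<sigma> = 1 \<or> \<sigma> = - 1"
  shows "\<bar>\<sigma> * (s / sqrt (s\<^sup>2 + \<gamma>\<^sup>2))\<bar> \<le> (1::real)"
proof -
  have "\<bar>s\<bar> \<le> sqrt (s\<^sup>2 + \<gamma>\<^sup>2)"
    by (rule real_le_rsqrt) simp
  then have "\<bar>s\<bar> / sqrt (s\<^sup>2 + \<gamma>\<^sup>2) \<le> 1"
    \<comment> \<open>In the degenerate case the quotient is \<open>0\<close> by convention.\<close>
    by (cases "s\<^sup>2 + \<gamma>\<^sup>2 = 0") (auto simp: divide_le_eq_1 sum_power2_gt_zero_iff)
  then show ?thesis
    using assms by (auto simp: abs_mult)
qed

lemma norm_band_velocity_le:
  assumes "m > 0" "\<gamma> > 0" "\<sigma> = 1 \<or> \<sigma> = - 1"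
  shows "norm (band_velocity \<sigma> m \<gamma> \<alpha> p) \<le> norm p / m + norm \<alpha>"
proof -
  let ?c = "\<sigma> * ((\<alpha> \<bullet> p) / sqrt ((\<alpha> \<bullet> p)\<^sup>2 + \<gamma>\<^sup>2))"
  have "norm (p /\<^sub>R m + ?c *\<^sub>R \<alpha>) \<le> norm (p /\<^sub>R m) + norm (?c *\<^sub>R \<alpha>)"
    by (rule norm_triangle_ineq)
  also have "norm (p /\<^sub>R m) = norm p / m"
    using assms(1) by (simp add: divide_inverse_commute)
  also have "norm (?c *\<^sub>R \<alpha>) \<le> norm \<alpha>"
    unfolding norm_scaleR using abs_band_factor_le[OF assms(3)]
    by (intro mult_left_le_one_le) auto
  finally show ?thesis
    unfolding band_velocity_eq[OF assms(1,2)] by simp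
qed

lemma continuous_on_band_velocity:
  assumes "m > 0" "\<gamma> > 0"
  shows "continuous_on S (band_velocity \<sigma> m \<gamma> \<alpha>)"
proof -
  have "(\<alpha> \<bullet> p)\<^sup>2 + \<gamma>\<^sup>2 \<noteq> 0" for p
    using assms(2) by (simp add: sum_power2_eq_zero_iff)
  then show ?thesis
    unfolding band_velocity_eq[OF assms, abs_def] by (auto intro!: continuous_intros)
qed

lemma continuous_on_band_energy: "m > 0 \<Longrightarrow> continuous_on S (band_energy \<sigma> m \<gamma> \<alpha>)"
  unfolding band_energy_def by (auto intro!: continuous_intros)

text \<open>Completing the square trades the linear term for half of the quadratic one, which leaves
  a Gaussian.\<close>

lemma quadratic_exponent_le:
  fixes a b n :: real
  assumes "a > 0"
  shows "b * n - a * n\<^sup>2 \<le> b\<^sup>2 / (2 * a) - a / 2 * n\<^sup>2"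
proof -
  have "0 \<le> (a * n - b)\<^sup>2 / (2 * a)"
    using assms by simp
  also have "\<dots> = b\<^sup>2 / (2 * a) - a / 2 * n\<^sup>2 - (b * n - a * n\<^sup>2)"
    using assms by (simp add: power2_eq_square field_simps)
  finally show ?thesis by simp
qed

lemma integrable_band_weight:
  assumes "m > 0" "\<beta> > 0" "\<gamma> > 0" "\<sigma> = 1 \<or> \<sigma> = - 1"
  shows "integrable lborel (\<lambda>p. exp (- \<beta> * band_energy \<sigma> m \<gamma> \<alpha> p)
    * exp (r * norm (band_velocity \<sigma> m \<gamma> \<alpha> p)))"
proof -
  \<comment> \<open>\<open>a\<close>, \<open>b\<close> and \<open>c\<close> collect the quadratic,
    linear and constant coefficients in \<open>norm p\<close> from the bounds on energy and
    velocity.\<close>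
  define a where "a = \<beta> / (2 * m)"
  define b where "b = \<beta> * norm \<alpha> + \<bar>r\<bar> / m"
  define c where "c = \<beta> * \<gamma> + \<bar>r\<bar> * norm \<alpha>"
  have "a > 0"
    using assms by (simp add: a_def)
  show ?thesis
  proof (rule Bochner_Integration.integrable_bound)
    show "integrable lborel (\<lambda>p::real^3. exp (c + b\<^sup>2 / (2 * a)) * exp (- (a / 2) * (norm p)\<^sup>2))"
      using integrable_gaussian[of "a / 2"] \<open>a > 0\<close> by (intro integrable_mult_right) simp
    have "- \<beta> * band_energy \<sigma> m \<gamma> \<alpha> p + r * norm (band_velocity \<sigma> m \<gamma> \<alpha> p)
        \<le> c + b\<^sup>2 / (2 * a) - a / 2 * (norm p)\<^sup>2" for p
    proof -
      have "- \<beta> * band_energy \<sigma> m \<gamma> \<alpha> p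
          \<le> - \<beta> * ((norm p)\<^sup>2 / (2 * m) - (norm \<alpha> * norm p + \<gamma>))"
        using band_energy_ge[OF assms(3,4)] assms(2) by simp
      moreover have "r * norm (band_velocity \<sigma> m \<gamma> \<alpha> p) \<le> \<bar>r\<bar> * (norm p / m + norm \<alpha>)"
        using norm_band_velocity_le[OF assms(1,3,4)] by (intro mult_mono) auto
      ultimately have "- \<beta> * band_energy \<sigma> m \<gamma> \<alpha> p + r * norm (band_velocity \<sigma> m \<gamma> \<alpha> p)
          \<le> c + (b * norm p - a * (norm p)\<^sup>2)"
        by (simp add: a_def b_def c_def algebra_simps)
      with quadratic_exponent_le[OF \<open>a > 0\<close>, of b "norm p"] show ?thesis
        by linarith
    qed
    then show "AE p in lborel. norm (exp (- \<beta> * band_energy \<sigma> m \<gamma> \<alpha> p)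
        * exp (r * norm (band_velocity \<sigma> m \<gamma> \<alpha> p)))
      \<le> norm (exp (c + b\<^sup>2 / (2 * a)) * exp (- (a / 2) * (norm p)\<^sup>2))"
      by (simp flip: exp_add)
  qed (use assms in \<open>auto intro!: borel_measurable_continuous_onI continuous_intros
      continuous_on_band_energy continuous_on_band_velocity\<close>)
qed

text \<open>Along the ray of \<open>u\<close> the free part \<open>p /\<^sub>R m\<close> grows
  without bound, while the interband part contributes at most
  \<open>\<bar>u \<bullet> \<alpha>\<bar>\<close>.\<close>

lemma band_velocity_unbounded:
  assumes "m > 0" "\<gamma> > 0" "\<sigma> = 1 \<or> \<sigma> = - 1" "u \<noteq> 0"
  shows "\<exists>p. u \<bullet> band_velocity \<sigma> m \<gamma> \<alpha> p > c"
proof -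
  \<comment> \<open>Chosen so that the free part contributes exactly
    \<open>\<bar>c\<bar> + \<bar>u \<bullet> \<alpha>\<bar> + 1\<close>.\<close>
  define t where "t = (\<bar>c\<bar> + \<bar>u \<bullet> \<alpha>\<bar> + 1) * m / (u \<bullet> u)"
  let ?s = "\<alpha> \<bullet> (t *\<^sub>R u)"
  let ?c = "\<sigma> * (?s / sqrt (?s\<^sup>2 + \<gamma>\<^sup>2))"
  have "\<bar>?c * (u \<bullet> \<alpha>)\<bar> \<le> \<bar>u \<bullet> \<alpha>\<bar>"
    unfolding abs_mult[of ?c] using abs_band_factor_le[OF assms(3)]
    by (intro mult_left_le_one_le) auto
  moreover have "u \<bullet> ((t *\<^sub>R u) /\<^sub>R m) = \<bar>c\<bar> + \<bar>u \<bullet> \<alpha>\<bar> + 1"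
    using assms(1,4) by (simp add: t_def)
  ultimately have "u \<bullet> ((t *\<^sub>R u) /\<^sub>R m + ?c *\<^sub>R \<alpha>) > c"
    unfolding inner_add_right inner_scaleR_right[of u ?c] by linarith
  then show ?thesis
    unfolding band_velocity_eq[OF assms(1,2)] by blast
qed

section \<open>The band model as an exponential family\<close>

lemma exponential_family_band:
  assumes "m > 0" "\<beta> > 0" "\<gamma> > 0" "\<sigma> = 1 \<or> \<sigma> = - 1"
  shows "exponential_family (density lborel (\<lambda>p. exp (- \<beta> * band_energy \<sigma> m \<gamma> \<alpha> p)))
    (band_velocity \<sigma> m \<gamma> \<alpha>)"
proof
  have E [measurable]: "band_energy \<sigma> m \<gamma> \<alpha> \<in> borel_measurable borel"
    using assms by (intro borel_measurable_continuous_onI continuous_on_band_energy)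
  have v [measurable]: "band_velocity \<sigma> m \<gamma> \<alpha> \<in> borel_measurable borel"
    using assms by (intro borel_measurable_continuous_onI continuous_on_band_velocity)
  let ?M = "density lborel (\<lambda>p. exp (- \<beta> * band_energy \<sigma> m \<gamma> \<alpha> p))"
  show "band_velocity \<sigma> m \<gamma> \<alpha> \<in> borel_measurable ?M"
    by simp
  show "integrable ?M (\<lambda>p. exp (r * norm (band_velocity \<sigma> m \<gamma> \<alpha> p)))" for r
    by (subst integrable_real_density) (use integrable_band_weight[OF assms] in auto)
  show "\<not> (AE p in ?M. u \<bullet> band_velocity \<sigma> m \<gamma> \<alpha> p \<le> c)" if "u \<noteq> 0" for u c
  proof
    assume "AE p in ?M. u \<bullet> band_velocity \<sigma> m \<gamma> \<alpha> p \<le> c"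
    \<comment> \<open>The density is positive, so the bound holds Lebesgue-almost everywhere; a
      closed set of full measure is the whole space, which contradicts unboundedness.\<close>
    then have ae: "AE p in lebesgue. p \<in> {p. u \<bullet> band_velocity \<sigma> m \<gamma> \<alpha> p \<le> c}"
      by (intro AE_completion) (simp add: AE_density)
    have "closed {p. u \<bullet> band_velocity \<sigma> m \<gamma> \<alpha> p \<le> c}"
      using assms by (intro closed_Collect_le continuous_intros continuous_on_band_velocity)
    from mem_closed_if_AE_lebesgue[OF this ae]
    have "u \<bullet> band_velocity \<sigma> m \<gamma> \<alpha> p \<le> c" for p
      by simp
    with band_velocity_unbounded[OF assms(1,3,4) that] show False
      by (meson not_less)
  qed
qed

text \<open>The first two conjuncts rule out default values: the integral converges and is positive,
  so \<open>ln\<close> is a true logarithm, and \<open>gradient f\<close> is a true gradient at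
  every point.\<close>

theorem theorem1:
  fixes m \<beta> \<gamma> \<sigma> :: real and \<alpha> :: "real^3"
  assumes "m > 0" and "\<beta> > 0" and "\<gamma> > 0"
    and "\<sigma> = 1 \<or> \<sigma> = - 1"
  defines "f \<equiv> log_partition \<sigma> m \<beta> \<gamma> \<alpha>"
  shows "(\<forall>B. exp (f B) =
             (LINT p|lborel. exp (- \<beta> * band_energy \<sigma> m \<gamma> \<alpha> p + B \<bullet> band_velocity \<sigma> m \<gamma> \<alpha> p)))
       \<and> (\<forall>B. GDERIV f B :> gradient f B)
       \<and> bij (gradient f)"
proof -
  interpret exponential_family "density lborel (\<lambda>p. exp (- \<beta> * band_energy \<sigma> m \<gamma> \<alpha> p))"
      "band_velocity \<sigma> m \<gamma> \<alpha>"
    by (rule exponential_family_band) fact+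
  \<comment> \<open>Moving the density into the integrand identifies the abstract partition function
    with the integral that defines \<open>f\<close>.\<close>
  have Z: "partition_function B = (LINT p|lborel.
      exp (- \<beta> * band_energy \<sigma> m \<gamma> \<alpha> p + B \<bullet> band_velocity \<sigma> m \<gamma> \<alpha> p))" for B
    unfolding partition_function_def exp_add
  proof (rule integral_real_density)
    show "(\<lambda>p. exp (- \<beta> * band_energy \<sigma> m \<gamma> \<alpha> p)) \<in> borel_measurable lborel"
      using assms by (auto intro!: borel_measurable_continuous_onI continuous_intros
          continuous_on_band_energy)
    show "(\<lambda>p. exp (B \<bullet> band_velocity \<sigma> m \<gamma> \<alpha> p)) \<in> borel_measurable lborel"
      using assms by (auto intro!: borel_measurable_continuous_onI continuous_intros
          continuous_on_band_velocity)
  qed simp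
  have f: "f = (\<lambda>B. ln (partition_function B))"
    unfolding f_def log_partition_def Z ..
  have grad: "gradient f = (\<lambda>B. moment B /\<^sub>R partition_function B)"
    unfolding f using gradient_eq[OF GDERIV_ln_partition] by blast
  have "exp (f B) = partition_function B" for B
    unfolding f using partition_pos by simp
  moreover have "GDERIV f B :> gradient f B" for B
    unfolding grad unfolding f by (rule GDERIV_ln_partition)
  moreover have "bij (gradient f)"
    unfolding grad bij_def using inj_mean surj_mean by blast
  ultimately show ?thesis
    by (simp only: Z) blast
qed

end
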